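(* Let $\phi$ be a formula not containing the operator $X_w$. If $\phi$ is satisfiable as an $\textit{LTL}_f$ formula (some finite trace in $\Sigma^*$ satisfies it), then $\phi$ is satisfiable as an LTL formula (some infinite trace in $\Sigma^\omega$ satisfies it).
   Context: Fix a finite set $\mathcal{P}$ of atomic propositions; $L=\mathcal{P}\cup\{\neg a: a\in\mathcal{P}\}$ is the set of literals and $\Sigma=2^{L}$. Formulas are in negation normal form: $\phi::=\mathsf{tt}\mid\mathsf{ff}\mid \ell\mid \phi\wedge\phi\mid\phi\vee\phi\mid X\phi\mid X_w\phi\mid \phi U\phi\mid\phi R\phi$, $\ell\in L$; $X_w$-free formulas are also LTL formulas. $\textit{LTL}_f$ semantics on nonempty finite traces $\eta=\omega_0\ldots\omega_n$ ($|\eta|=n+1$, $\eta_i=\omega_i\ldots\omega_n$): $\eta\models\mathsf{tt}$, $\eta\not\models\mathsf{ff}$; $\eta\models\ell$ iff $\ell\in\omega_0$; $\wedge,\vee$ as usual; $\eta\models X\psi$ iff $|\eta|>1$ and $\eta_1\models\psi$; $\eta\models X_w\psi$ iff $|\eta|=1$ or ($|\eta|>1$ and $\eta_1\models\psi$); $\eta\models\phi_1U\phi_2$ iff some $0\le i<|\eta|$ has $\eta_i\models\phi_2$ and $\eta_j\models\phi_1$ for all $j<i$; $\eta\models\phi_1R\phi_2$ iff either $\eta_i\models\phi_2$ for all $0\le i<|\eta|$, or some $0\le i<|\eta|$ has $\eta_i\models\phi_1$ and $\eta_j\models\phi_2$ for all $j\le i$. LTL semantics on infinite traces $\xi=\omega_0\omega_1\cdots$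 with suffixes $\xi_i$: $\xi\models\mathsf{tt}$, $\xi\not\models\mathsf{ff}$; $\xi\models\ell$ iff $\ell\in\omega_0$; $\wedge,\vee$ as usual; $\xi\models X\psi$ iff $\xi_1\models\psi$; $\xi\models\phi_1U\phi_2$ iff some $i\ge0$ has $\xi_i\models\phi_2$ and $\xi_j\models\phi_1$ for all $j<i$; $\xi\models\phi_1R\phi_2$ iff either $\xi_i\models\phi_2$ for all $i\ge0$, or some $i\ge0$ has $\xi_i\models\phi_1$ and $\xi_j\models\phi_2$ for all $j\le i$. *)

theory Defs
  imports Main "HOL-Library.Stream"
begin

datatype (lit_atoms: 'a) literal = Pos 'a | Neg 'a

datatype (atoms: 'a) formula =
    TT
  | FF
  | Lit "'a literal"
  | And "'a formula" "'a formula"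
  | Or "'a formula" "'a formula"
  | Next "'a formula"
  | WeakNext "'a formula"
  | Until "'a formula" "'a formula"
  | Release "'a formula" "'a formula"

definition literals :: "'a set \<Rightarrow> 'a literal set" where
  "literals P = Pos ` P \<union> Neg ` P"

text \<open>Letters are arbitrary sets of literals: a letter may contain both or neither
  of an atom and its negation.\<close>

definition alphabet :: "'a set \<Rightarrow> 'a literal set set" where
  "alphabet P = Pow (literals P)"

primrec weak_next_free :: "'a formula \<Rightarrow> bool" where
  "weak_next_free TT \<longleftrightarrow> True"
| "weak_next_free FF \<longleftrightarrow> True"
| "weak_next_free (Lit l) \<longleftrightarrow> True"
| "weak_next_free (And \<phi> \<psi>) \<longleftrightarrow> weak_next_free \<phi> \<and> weak_next_free \<psi>"
| "weak_next_free (Or \<phi> \<psi>) \<longleftrightarrow> weak_next_free \<phi> \<and> weak_next_free \<psi>"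
| "weak_next_free (Next \<phi>) \<longleftrightarrow> weak_next_free \<phi>"
| "weak_next_free (WeakNext \<phi>) \<longleftrightarrow> False"
| "weak_next_free (Until \<phi> \<psi>) \<longleftrightarrow> weak_next_free \<phi> \<and> weak_next_free \<psi>"
| "weak_next_free (Release \<phi> \<psi>) \<longleftrightarrow> weak_next_free \<phi> \<and> weak_next_free \<psi>"

text \<open>Only meaningful for nonempty \<open>\<eta>\<close>; the recursion never passes from a nonempty
  trace to an empty one.\<close>

primrec ltlf_sat :: "'a literal set list \<Rightarrow> 'a formula \<Rightarrow> bool" where
  "ltlf_sat \<eta> TT \<longleftrightarrow> True"
| "ltlf_sat \<eta> FF \<longleftrightarrow> False"
| "ltlf_sat \<eta> (Lit l) \<longleftrightarrow> l \<in> hd \<eta>"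
| "ltlf_sat \<eta> (And \<phi> \<psi>) \<longleftrightarrow> ltlf_sat \<eta> \<phi> \<and> ltlf_sat \<eta> \<psi>"
| "ltlf_sat \<eta> (Or \<phi> \<psi>) \<longleftrightarrow> ltlf_sat \<eta> \<phi> \<or> ltlf_sat \<eta> \<psi>"
| "ltlf_sat \<eta> (Next \<phi>) \<longleftrightarrow> length \<eta> > 1 \<and> ltlf_sat (drop 1 \<eta>) \<phi>"
| "ltlf_sat \<eta> (WeakNext \<phi>) \<longleftrightarrow>
     length \<eta> = 1 \<or> (length \<eta> > 1 \<and> ltlf_sat (drop 1 \<eta>) \<phi>)"
| "ltlf_sat \<eta> (Until \<phi> \<psi>) \<longleftrightarrow>
     (\<exists>i<length \<eta>. ltlf_sat (drop i \<eta>) \<psi> \<and> (\<forall>j<i. ltlf_sat (drop j \<eta>) \<phi>))"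
| "ltlf_sat \<eta> (Release \<phi> \<psi>) \<longleftrightarrow>
     (\<forall>i<length \<eta>. ltlf_sat (drop i \<eta>) \<psi>) \<or>
     (\<exists>i<length \<eta>. ltlf_sat (drop i \<eta>) \<phi> \<and> (\<forall>j\<le>i. ltlf_sat (drop j \<eta>) \<psi>))"

text \<open>LTL has no weak next operator, so the value on \<^const>\<open>WeakNext\<close> is deliberately
  left unspecified.\<close>

primrec (nonexhaustive) ltl_sat :: "'a literal set stream \<Rightarrow> 'a formula \<Rightarrow> bool" where
  "ltl_sat \<xi> TT \<longleftrightarrow> True"
| "ltl_sat \<xi> FF \<longleftrightarrow> False"
| "ltl_sat \<xi> (Lit l) \<longleftrightarrow> l \<in> shd \<xi>"
| "ltl_sat \<xi> (And \<phi> \<psi>) \<longleftrightarrow> ltl_sat \<xi> \<phi> \<and> ltl_sat \<xi> \<psi>"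
| "ltl_sat \<xi> (Or \<phi> \<psi>) \<longleftrightarrow> ltl_sat \<xi> \<phi> \<or> ltl_sat \<xi> \<psi>"
| "ltl_sat \<xi> (Next \<phi>) \<longleftrightarrow> ltl_sat (sdrop 1 \<xi>) \<phi>"
| "ltl_sat \<xi> (Until \<phi> \<psi>) \<longleftrightarrow>
     (\<exists>i. ltl_sat (sdrop i \<xi>) \<psi> \<and> (\<forall>j<i. ltl_sat (sdrop j \<xi>) \<phi>))"
| "ltl_sat \<xi> (Release \<phi> \<psi>) \<longleftrightarrow>
     (\<forall>i. ltl_sat (sdrop i \<xi>) \<psi>) \<or>
     (\<exists>i. ltl_sat (sdrop i \<xi>) \<phi> \<and> (\<forall>j\<le>i. ltl_sat (sdrop j \<xi>) \<psi>))"

definition ltlf_satisfiable :: "'a set \<Rightarrow> 'a formula \<Rightarrow> bool" where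
  "ltlf_satisfiable P \<phi> \<longleftrightarrow> (\<exists>\<eta> \<in> lists (alphabet P). \<eta> \<noteq> [] \<and> ltlf_sat \<eta> \<phi>)"

definition ltl_satisfiable :: "'a set \<Rightarrow> 'a formula \<Rightarrow> bool" where
  "ltl_satisfiable P \<phi> \<longleftrightarrow> (\<exists>\<xi> \<in> streams (alphabet P). ltl_sat \<xi> \<phi>)"

end

theory Submission
  imports Defs
begin

text \<open>Repeat the last letter of a finite model forever. Every suffix of the resulting infinite
  trace is again such an extension of a nonempty suffix of the finite trace, so truth transfers
  by induction on the formula. Weak next is the one operator for which this fails: on a trace of
  length one it holds for lack of a successor, but in the extension a successor exists.\<close>

definition stutter_last :: "'a list \<Rightarrow> 'a stream" where
  "stutter_last xs = xs @- sconst (last xs)"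

lemma shd_stutter_last: "xs \<noteq> [] \<Longrightarrow> shd (stutter_last xs) = hd xs"
  by (simp add: stutter_last_def)

lemma sdrop_stutter_last_less:
  assumes "i < length xs"
  shows "sdrop i (stutter_last xs) = stutter_last (drop i xs)"
  using assms by (simp add: stutter_last_def sdrop_shift)

text \<open>From the end on only copies of the last letter remain, and these also form the extension
  of the one-letter suffix. Here \<open>drop i xs\<close> would be empty and its \<open>last\<close>
  unspecified, hence the index \<open>length xs - 1\<close>.\<close>

lemma sdrop_stutter_last_ge:
  assumes "xs \<noteq> []" "length xs \<le> i"
  shows "sdrop i (stutter_last xs) = stutter_last (drop (length xs - 1) xs)"
proof -
  have "drop (length xs - 1) xs = [last xs]"
    using assms(1) by (cases xs rule: rev_cases) auto
  moreover have "sconst (last xs) = last xs ## sconst (last xs)"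
    by (subst siterate.code) simp
  ultimately show ?thesis
    using assms(2) by (simp add: stutter_last_def sdrop_shift sdrop_siterate)
qed

lemma stutter_last_in_streams:
  assumes "xs \<in> lists A" "xs \<noteq> []"
  shows "stutter_last xs \<in> streams A"
  using assms unfolding stutter_last_def
  by (auto intro!: shift_streams simp: sset_sconst streams_iff_sset)

lemma ltlf_sat_imp_ltl_sat_stutter_last:
  assumes "weak_next_free \<phi>" "\<eta> \<noteq> []" "ltlf_sat \<eta> \<phi>"
  shows "ltl_sat (stutter_last \<eta>) \<phi>"
  using assms
proof (induction \<phi> arbitrary: \<eta>)
  case (Lit l)
  then show ?case by (simp add: shd_stutter_last)
next
  case (Next \<phi>)
  then have "ltl_sat (stutter_last (drop 1 \<eta>)) \<phi>" by auto
  \<comment> \<open>The strong next supplies \<open>1 < length \<eta>\<close>. Full simplification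
    would turn \<open>sdrop 1\<close> into \<open>stl\<close>, hiding the pattern of the suffix
    lemma.\<close>
  with Next.prems show ?case
    by (simp only: ltl_sat.simps ltlf_sat.simps sdrop_stutter_last_less)
next
  case (Until \<phi> \<psi>)
  then obtain i where i: "i < length \<eta>" "ltlf_sat (drop i \<eta>) \<psi>"
      "\<forall>j<i. ltlf_sat (drop j \<eta>) \<phi>"
    by auto
  then have "ltl_sat (sdrop i (stutter_last \<eta>)) \<psi>"
    using Until by (simp add: sdrop_stutter_last_less)
  moreover have "\<forall>j<i. ltl_sat (sdrop j (stutter_last \<eta>)) \<phi>"
    using Until i by (simp add: sdrop_stutter_last_less)
  ultimately show ?case by auto
next
  case (Release \<phi> \<psi>)
  from Release.prems(3) consider
      (always) "\<forall>i<length \<eta>. ltlf_sat (drop i \<eta>) \<psi>"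
    | (release) i where "i < length \<eta>" "ltlf_sat (drop i \<eta>) \<phi>"
        "\<forall>j\<le>i. ltlf_sat (drop j \<eta>) \<psi>"
    by auto
  then show ?case
  proof cases
    case always
    have sat: "ltl_sat (stutter_last (drop i \<eta>)) \<psi>" if "i < length \<eta>" for i
      using Release always that by simp
    have "ltl_sat (sdrop i (stutter_last \<eta>)) \<psi>" for i
    proof (cases "i < length \<eta>")
      case True
      then show ?thesis using sat by (simp add: sdrop_stutter_last_less)
    next
      case False
      \<comment> \<open>Past the end, \<open>i\<close> is traded for the last position of \<eta>,
        which exists since \<eta> is nonempty and where \<psi> is already known.\<close>
      then show ?thesis
        using sat[of "length \<eta> - 1"] Release.prems(2) by (simp add: sdrop_stutter_last_ge)
    qed
    then show ?thesis by simp
  next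
    case release
    then have "ltl_sat (sdrop i (stutter_last \<eta>)) \<phi>"
      using Release by (simp add: sdrop_stutter_last_less)
    moreover have "\<forall>j\<le>i. ltl_sat (sdrop j (stutter_last \<eta>)) \<psi>"
      using Release release by (simp add: sdrop_stutter_last_less)
    ultimately show ?thesis by auto
  qed
\<comment> \<open>The case of \<open>WeakNext\<close>, where \<open>ltl_sat\<close> is unspecified,
  is vacuous by \<open>weak_next_free\<close>.\<close>
qed auto

theorem theorem3:
  fixes P :: "'a set" and \<phi> :: "'a formula"
  assumes "finite P"
    and "atoms \<phi> \<subseteq> P"
    and "weak_next_free \<phi>"
    and "ltlf_satisfiable P \<phi>"
  shows "ltl_satisfiable P \<phi>"
  using assms(3,4) unfolding ltlf_satisfiable_def ltl_satisfiable_def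
  by (blast intro: stutter_last_in_streams ltlf_sat_imp_ltl_sat_stutter_last)

end
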